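(* The probability that a growing self-avoiding walk (GSAW) on the bi-infinite ladder graph $L_\infty$ terminates is $1$.
   Context: $L_\infty$ is the graph with vertex set $\{(a,b): a\in\mathbb{Z},\ b\in\{1,2\}\}$, where $(a,b)$ and $(a',b')$ are adjacent iff ($b=b'$ and $|a-a'|=1$) or ($a=a'$ and $b\ne b'$). All starting vertices are equivalent by symmetry. A growing self-avoiding walk (GSAW) on a graph is the random process that starts at a given vertex and at each step moves to a vertex chosen uniformly at random among the neighbors of the current vertex that have not yet been visited; it terminates (is trapped) when the current vertex has no unvisited neighbor. *)

theory Defs
  imports "HOL-Probability.Probability"
begin

text \<open>
  A graph is given by its vertex set \<open>V\<close> and its adjacency relation \<open>E\<close>. A trajectory of the walk
  is a sequence \<open>\<omega> :: nat \<Rightarrow> 'v\<close>, where \<open>\<omega> n\<close> is the position at time \<open>n\<close>.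
\<close>

definition unvisited_nbrs :: "'v set \<Rightarrow> ('v \<Rightarrow> 'v \<Rightarrow> bool) \<Rightarrow> (nat \<Rightarrow> 'v) \<Rightarrow> nat \<Rightarrow> 'v set" where
  "unvisited_nbrs V E \<omega> n = {w \<in> V. E (\<omega> n) w \<and> w \<notin> \<omega> ` {..n}}"

definition trapped_at :: "'v set \<Rightarrow> ('v \<Rightarrow> 'v \<Rightarrow> bool) \<Rightarrow> (nat \<Rightarrow> 'v) \<Rightarrow> nat \<Rightarrow> bool" where
  "trapped_at V E \<omega> n \<longleftrightarrow> unvisited_nbrs V E \<omega> n = {}"

definition terminates :: "'v set \<Rightarrow> ('v \<Rightarrow> 'v \<Rightarrow> bool) \<Rightarrow> (nat \<Rightarrow> 'v) \<Rightarrow> bool" where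
  "terminates V E \<omega> \<longleftrightarrow> (\<exists>n. trapped_at V E \<omega> n)"

text \<open>
  \<open>gsaw_step V E s n \<omega>\<close> is the conditional law of the \<open>n\<close>-th position given the history
  \<open>\<omega> 0, \<dots>, \<omega> (n - 1)\<close>; it does not look at later values of \<open>\<omega>\<close>. In order that every trajectory is
  an infinite sequence, a trapped walk rests at its last vertex for ever (it then stays trapped).
  The graph has to be locally finite, since \<open>pmf_of_set\<close> is unspecified on infinite sets.
\<close>

definition gsaw_step ::
  "'v set \<Rightarrow> ('v \<Rightarrow> 'v \<Rightarrow> bool) \<Rightarrow> 'v \<Rightarrow> nat \<Rightarrow> (nat \<Rightarrow> 'v) \<Rightarrow> 'v pmf" where
  "gsaw_step V E s n \<omega> =
     (case n of
        0 \<Rightarrow> return_pmf s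
      | Suc m \<Rightarrow>
          if trapped_at V E \<omega> m then return_pmf (\<omega> m)
          else pmf_of_set (unvisited_nbrs V E \<omega> m))"

text \<open>
  The law of the whole trajectory of the GSAW started at \<open>s\<close>: the probability measure on the product
  sigma-algebra of \<open>nat \<Rightarrow> 'v\<close> that the Ionescu-Tulcea theorem yields from the kernels
  \<open>gsaw_step V E s n\<close>. Lemmas \<open>prob_space_gsaw\<close>, \<open>sets_gsaw\<close> and \<open>measure_gsaw_cylinder_Suc\<close> below
  confirm this.
\<close>

definition gsaw ::
  "'v::countable set \<Rightarrow> ('v \<Rightarrow> 'v \<Rightarrow> bool) \<Rightarrow> 'v \<Rightarrow> (nat \<Rightarrow> 'v) measure" where
  "gsaw V E s =
     projective_family.lim UNIV
       (Ionescu_Tulcea.CI (\<lambda>n \<omega>. measure_pmf (gsaw_step V E s n \<omega>)) (\<lambda>_. count_space UNIV))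
       (\<lambda>_. count_space UNIV)"

definition ladder_verts :: "(int \<times> nat) set" where
  "ladder_verts = UNIV \<times> {1, 2}"

definition ladder_adj :: "int \<times> nat \<Rightarrow> int \<times> nat \<Rightarrow> bool" where
  "ladder_adj = (\<lambda>(a, b) (a', b'). (b = b' \<and> \<bar>a - a'\<bar> = 1) \<or> (a = a' \<and> b \<noteq> b'))"

lemma gsaw_step_cong:
  assumes "\<And>i. i < n \<Longrightarrow> \<omega> i = \<omega>' i"
  shows "gsaw_step V E s n \<omega> = gsaw_step V E s n \<omega>'"
proof (cases n)
  case (Suc m)
  have "\<omega> ` {..m} = \<omega>' ` {..m}" "\<omega> m = \<omega>' m"
    using assms Suc by (auto intro!: image_cong)
  then have "unvisited_nbrs V E \<omega> m = unvisited_nbrs V E \<omega>' m"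
    by (simp add: unvisited_nbrs_def)
  with \<open>\<omega> m = \<omega>' m\<close> show ?thesis
    by (simp add: Suc gsaw_step_def trapped_at_def)
qed (simp add: gsaw_step_def)

lemma Ionescu_Tulcea_gsaw:
  fixes s :: "'v::countable"
  shows "Ionescu_Tulcea (\<lambda>n \<omega>. measure_pmf (gsaw_step V E s n \<omega>)) (\<lambda>_. count_space UNIV)"
proof
  fix i :: nat
  have "PiM {0..<i} (\<lambda>_. count_space (UNIV :: 'v set)) = count_space (PiE {0..<i} (\<lambda>_. UNIV))"
    by (intro count_space_PiM_finite) auto
  then show "(\<lambda>\<omega>. measure_pmf (gsaw_step V E s i \<omega>))
      \<in> PiM {0..<i} (\<lambda>_. count_space UNIV) \<rightarrow>\<^sub>M subprob_algebra (count_space UNIV)"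
    by (simp add: measure_pmf_in_subprob_algebra)
qed

context
  fixes V :: "'v::countable set" and E :: "'v \<Rightarrow> 'v \<Rightarrow> bool" and s :: 'v
begin

interpretation IT: Ionescu_Tulcea
  "\<lambda>n \<omega>. measure_pmf (gsaw_step V E s n \<omega>)" "\<lambda>_. count_space UNIV"
  by (rule Ionescu_Tulcea_gsaw)

lemma gsaw_eq: "gsaw V E s = IT.PF.lim"
  by (simp add: gsaw_def)

lemma sets_gsaw: "sets (gsaw V E s) = sets (PiM UNIV (\<lambda>_. count_space UNIV))"
  by (simp add: gsaw_eq)

lemma space_gsaw: "space (gsaw V E s) = UNIV"
  by (simp add: gsaw_eq space_PiM)

lemma emeasure_gsaw_cylinder:
  "emeasure (gsaw V E s) {\<omega>. \<forall>i<n. \<omega> i = x i} =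
     emeasure (IT.C 0 n (\<lambda>_. undefined)) {restrict x {0..<n}}"
proof -
  have fin: "PiM {0..<n} (\<lambda>_. count_space (UNIV :: 'v set)) = count_space (PiE {0..<n} (\<lambda>_. UNIV))"
    by (intro count_space_PiM_finite) auto
  have X: "{restrict x {0..<n}} \<in> sets (PiM {0..<n} (\<lambda>_. count_space UNIV))"
    unfolding fin by auto
  have "IT.PF.emb UNIV {0..<n} {restrict x {0..<n}} = {\<omega>. \<forall>i<n. \<omega> i = x i}"
    by (auto simp: prod_emb_def space_PiM fun_eq_iff restrict_def split: if_splits)
  then have "emeasure (gsaw V E s) {\<omega>. \<forall>i<n. \<omega> i = x i} = emeasure (IT.CI {0..<n}) {restrict x {0..<n}}"
    using IT.lim[OF _ X] by (simp add: gsaw_eq)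
  also have "\<dots> = emeasure (IT.C 0 n (\<lambda>_. undefined)) {restrict x {0..<n}}"
    using IT.emeasure_CI[OF order_refl X] X
    by (simp add: prod_emb_id)
  finally show ?thesis .
qed

lemma prob_space_gsaw: "prob_space (gsaw V E s)"
proof
  have "emeasure (gsaw V E s) {\<omega>. \<forall>i<0::nat. \<omega> i = undefined} = 1"
    unfolding emeasure_gsaw_cylinder
    by (simp add: restrict_def PiM_empty)
  then show "emeasure (gsaw V E s) (space (gsaw V E s)) = 1"
    by (simp add: space_gsaw)
qed

lemma measure_gsaw_cylinder_Suc:
  "measure (gsaw V E s) {\<omega>. \<forall>i<Suc n. \<omega> i = x i} =
     measure (gsaw V E s) {\<omega>. \<forall>i<n. \<omega> i = x i} * pmf (gsaw_step V E s n x) (x n)"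
proof -
  let ?M = "\<lambda>_::nat. count_space (UNIV :: 'v set)"
  let ?x = "\<lambda>n. restrict x {0..<n}"
  let ?C = "\<lambda>n. IT.C 0 n (\<lambda>_. undefined)"
  have fin: "PiM {0..<k} ?M = count_space (PiE {0..<k} (\<lambda>_. UNIV))" for k
    by (intro count_space_PiM_finite) auto
  have X: "{?x k} \<in> sets (PiM {0..<k} ?M)" for k
    unfolding fin by auto
  have sp: "(\<lambda>_. undefined) \<in> space (PiM {0..<0} ?M)"
    by (simp add: space_PiM)
  have eP: "emeasure (IT.eP n \<omega>) {?x (Suc n)} =
      ennreal (pmf (gsaw_step V E s n x) (x n)) * indicator {?x n} \<omega>"
    if \<omega>: "\<omega> \<in> space (PiM {0..<n} ?M)" for \<omega>
  proof -
    have "(\<lambda>v. fun_upd \<omega> n v) -` {?x (Suc n)} = (if \<omega> = ?x n then {x n} else {})"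
    proof -
      have undef: "\<omega> i = undefined" if "\<not> i < n" for i
        using \<omega> that by (auto simp: space_PiM PiE_def extensional_def)
      have "fun_upd \<omega> n v = ?x (Suc n) \<longleftrightarrow> v = x n \<and> \<omega> = ?x n" for v
      proof
        assume L: "fun_upd \<omega> n v = ?x (Suc n)"
        have "\<omega> i = ?x n i" for i
          using fun_cong[OF L, of i] undef[of i] by (cases "i < n") auto
        then show "v = x n \<and> \<omega> = ?x n"
          using fun_cong[OF L, of n] by auto
      next
        assume R: "v = x n \<and> \<omega> = ?x n"
        show "fun_upd \<omega> n v = ?x (Suc n)"
          using R by (intro ext) auto
      qed
      then show ?thesis
        by (simp add: vimage_def del: restrict_apply)
    qed
    moreover have "gsaw_step V E s n (?x n) = gsaw_step V E s n x"
      by (rule gsaw_step_cong) simp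
    ultimately show ?thesis
      unfolding IT.emeasure_eP[OF \<omega> X[of "Suc n"]]
      by (simp add: emeasure_pmf_single del: restrict_apply)
  qed
  have "emeasure (?C (Suc n)) {?x (Suc n)} = (\<integral>\<^sup>+\<omega>. emeasure (IT.eP n \<omega>) {?x (Suc n)} \<partial>?C n)"
  proof -
    have ne: "space (?C n) \<noteq> {}"
      using prob_space.not_empty[OF IT.prob_space_C[OF sp]] .
    have "sets (?C n) = sets (PiM {0..<n} ?M)"
      using IT.sets_C[OF sp, of n] by simp
    then have m: "IT.eP n \<in> ?C n \<rightarrow>\<^sub>M subprob_algebra (PiM {0..<Suc n} ?M)"
      using IT.measurable_eP[of n] measurable_cong_sets by blast
    show ?thesis
      using emeasure_bind[OF ne m X] by simp
  qed
  also have "\<dots> = (\<integral>\<^sup>+\<omega>. ennreal (pmf (gsaw_step V E s n x) (x n)) * indicator {?x n} \<omega> \<partial>?C n)"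
    using IT.space_C[OF sp, of n] by (intro nn_integral_cong eP) simp
  also have "\<dots> = ennreal (pmf (gsaw_step V E s n x) (x n)) * emeasure (?C n) {?x n}"
    using X[of n] IT.sets_C[OF sp, of n] by (subst nn_integral_cmult_indicator) auto
  finally show ?thesis
    by (simp add: measure_def emeasure_gsaw_cylinder enn2real_mult mult.commute del: IT.C.simps)
qed

end

end

theory Submission
  imports Defs
begin

text \<open>
  The number of steps until the walk is trapped cannot be controlled uniformly in the history: after
  a long straight run along one rail the walk may step to the other rail and is then forced to walk
  all the way back. But on such a stretch it has no choice, so the stretch costs no probability. Hence
  the right uniform statement is that every history of the walk has one finite continuation that
  ends in a trap and has conditional probability at least \<open>p\<close>, where \<open>p > 0\<close> does not depend on the
  history, while the length of the continuation may.

  On any locally finite graph this suffices (\<open>gsaw_terminates_if_trap_bound\<close>). If the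
  conditional probability of surviving for ever is at most \<open>a\<close> after every history, then it is at
  most \<open>(1 - p) * a\<close> after every history, since the continuation into the trap does not
  contribute (\<open>survival_le_of_trap_bound\<close>). Iterating from \<open>a = 1\<close> gives survival probability \<open>0\<close>.

  On the ladder \<open>p = 1 / 3 ^ 6\<close> works. If all columns on one side of the walker are unvisited, it can
  trap itself there in six steps, by changing rails in the next column, walking on and curling back
  (\<open>trap_bound_fresh_half_ladder\<close>). If there are visited columns on both sides, the walk has crossed
  the current column before, and together with its last position this leaves at most one
  free neighbour (\<open>forced_between_visited_columns\<close>). A forced step stays within the range of
  columns visited already and uses up one of its finitely many free vertices, so after finitely many
  forced steps the walk is trapped or has an unvisited side (\<open>trap_bound_ladder\<close>).
\<close>

section \<open>Trapping with probability bounded below\<close>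

definition free_nbrs :: "'v set \<Rightarrow> ('v \<Rightarrow> 'v \<Rightarrow> bool) \<Rightarrow> 'v set \<Rightarrow> 'v \<Rightarrow> 'v set" where
  "free_nbrs V E S v = {w \<in> V. E v w \<and> w \<notin> S}"

lemma unvisited_nbrs_eq_free_nbrs:
  "unvisited_nbrs V E \<omega> n = free_nbrs V E (\<omega> ` {..n}) (\<omega> n)"
  by (simp add: unvisited_nbrs_def free_nbrs_def)

lemma image_atMost_fun_upd_Suc: "(fun_upd \<omega> (Suc n) w) ` {..Suc n} = insert w (\<omega> ` {..n})"
  by (auto simp: atMost_Suc)

text \<open>
  With \<open>S\<close> the set of visited vertices and \<open>v \<in> S\<close> the current one, \<open>p\<close> is a lower bound for the
  probability that the walk follows one particular finite path into a trap. Only \<open>S\<close> and \<open>v\<close>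
  matter for the future of the walk, so the order of the visits is left out. In the second rule \<open>q\<close>
  is a bound after the step to \<open>w\<close>, and that step has probability \<open>1 / card (free_nbrs V E S v)\<close>.
\<close>

inductive trap_bound :: "'v set \<Rightarrow> ('v \<Rightarrow> 'v \<Rightarrow> bool) \<Rightarrow> 'v set \<Rightarrow> 'v \<Rightarrow> real \<Rightarrow> bool"
  for V E where
  trapped: "free_nbrs V E S v = {} \<Longrightarrow> (p :: real) \<le> 1 \<Longrightarrow> trap_bound V E S v p"
| step: "w \<in> free_nbrs V E S v \<Longrightarrow> trap_bound V E (insert w S) w q
    \<Longrightarrow> p * real (card (free_nbrs V E S v)) \<le> q \<Longrightarrow> trap_bound V E S v p"

text \<open>
  These are the histories of positive probability along which the walk is not trapped before time
  \<open>n\<close>. It may be trapped at time \<open>n\<close>.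
\<close>

definition gsaw_history ::
  "'v set \<Rightarrow> ('v \<Rightarrow> 'v \<Rightarrow> bool) \<Rightarrow> 'v \<Rightarrow> (nat \<Rightarrow> 'v) \<Rightarrow> nat \<Rightarrow> bool" where
  "gsaw_history V E s \<omega> n \<longleftrightarrow> \<omega> 0 = s \<and> (\<forall>i<n. \<omega> (Suc i) \<in> unvisited_nbrs V E \<omega> i)"

lemma unvisited_nbrs_cong:
  assumes "\<And>i. i \<le> n \<Longrightarrow> \<omega> i = \<omega>' i"
  shows "unvisited_nbrs V E \<omega> n = unvisited_nbrs V E \<omega>' n"
proof -
  have "\<omega> ` {..n} = \<omega>' ` {..n}"
    using assms by (auto intro!: image_cong)
  with assms[of n] show ?thesis
    by (simp add: unvisited_nbrs_def)
qed

lemma gsaw_history_extend: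
  assumes "gsaw_history V E s \<omega> n" "w \<in> unvisited_nbrs V E \<omega> n"
  shows "gsaw_history V E s (fun_upd \<omega> (Suc n) w) (Suc n)"
proof -
  have "unvisited_nbrs V E (fun_upd \<omega> (Suc n) w) i = unvisited_nbrs V E \<omega> i" if "i \<le> n" for i
    by (rule unvisited_nbrs_cong) (use that in auto)
  with assms show ?thesis
    by (auto simp: gsaw_history_def less_Suc_eq)
qed

section \<open>From trapping bounds to almost sure termination\<close>

definition cylinder :: "(nat \<Rightarrow> 'v) \<Rightarrow> nat \<Rightarrow> (nat \<Rightarrow> 'v) set" where
  "cylinder \<omega> n = {\<omega>'. \<forall>i<Suc n. \<omega>' i = \<omega> i}"

lemma cylinder_fun_upd_Suc:
  "cylinder (fun_upd \<omega> (Suc n) w) (Suc n) = {\<omega>' \<in> cylinder \<omega> n. \<omega>' (Suc n) = w}"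
  by (auto simp: cylinder_def less_Suc_eq)

lemma measurable_coordinate_gsaw:
  "(\<lambda>\<omega>. \<omega> i) \<in> gsaw V E s \<rightarrow>\<^sub>M count_space UNIV"
  by (subst measurable_cong_sets[OF sets_gsaw refl]) (rule measurable_component_singleton, simp)

lemma sets_cylinder: "cylinder \<omega> n \<in> sets (gsaw V E s)"
proof -
  note measurable_coordinate_gsaw[of _ V E s, measurable]
  have "{\<omega>' \<in> space (gsaw V E s). \<forall>i<Suc n. \<omega>' i = \<omega> i} \<in> sets (gsaw V E s)"
    by measurable
  then show ?thesis by (simp add: space_gsaw cylinder_def)
qed

lemma sets_terminates: "{\<omega>. terminates V E \<omega>} \<in> sets (gsaw V E s)"
proof -
  note measurable_coordinate_gsaw[of _ V E s, measurable]
  have "{\<omega> \<in> space (gsaw V E s). \<exists>n. \<forall>w. w \<in> V \<longrightarrow> E (\<omega> n) w \<longrightarrow> (\<exists>i\<in>{..n}. \<omega> i = w)}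
      \<in> sets (gsaw V E s)"
    by measurable
  also have "{\<omega> \<in> space (gsaw V E s). \<exists>n. \<forall>w. w \<in> V \<longrightarrow> E (\<omega> n) w \<longrightarrow> (\<exists>i\<in>{..n}. \<omega> i = w)}
      = {\<omega>. terminates V E \<omega>}"
    unfolding terminates_def trapped_at_def unvisited_nbrs_def space_gsaw by blast
  finally show ?thesis .
qed

lemma measure_cylinder_extend:
  assumes "finite (unvisited_nbrs V E \<omega> n)" "w \<in> unvisited_nbrs V E \<omega> n"
  shows "measure (gsaw V E s) (cylinder (fun_upd \<omega> (Suc n) w) (Suc n)) =
    measure (gsaw V E s) (cylinder \<omega> n) / card (unvisited_nbrs V E \<omega> n)"
proof -
  have "gsaw_step V E s (Suc n) (fun_upd \<omega> (Suc n) w) = gsaw_step V E s (Suc n) \<omega>"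
    by (rule gsaw_step_cong) simp
  also have "pmf \<dots> w = 1 / card (unvisited_nbrs V E \<omega> n)"
    using assms by (auto simp: gsaw_step_def trapped_at_def pmf_of_set)
  finally have "pmf (gsaw_step V E s (Suc n) (fun_upd \<omega> (Suc n) w)) w = 1 / card (unvisited_nbrs V E \<omega> n)" .
  moreover have "cylinder (fun_upd \<omega> (Suc n) w) n = cylinder \<omega> n"
    by (simp add: cylinder_def)
  ultimately show ?thesis
    using measure_gsaw_cylinder_Suc[where x = "fun_upd \<omega> (Suc n) w" and n = "Suc n" and V = V and E = E and s = s]
    by (simp only: cylinder_def[symmetric] fun_upd_same) simp
qed

text \<open>
  Up to a null set the cylinder is the disjoint union of its extensions by a free neighbour: by
  \<open>measure_cylinder_extend\<close> the measures of these finitely many extensions already add up to the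
  measure of the cylinder.
\<close>

lemma measure_cylinder_Int_le_sum:
  assumes "finite (unvisited_nbrs V E \<omega> n)" "unvisited_nbrs V E \<omega> n \<noteq> {}"
    and B: "B \<in> sets (gsaw V E s)"
  shows "measure (gsaw V E s) (cylinder \<omega> n \<inter> B) \<le>
    (\<Sum>w\<in>unvisited_nbrs V E \<omega> n. measure (gsaw V E s) (cylinder (fun_upd \<omega> (Suc n) w) (Suc n) \<inter> B))"
proof -
  interpret prob_space "gsaw V E s" by (rule prob_space_gsaw)
  let ?U = "unvisited_nbrs V E \<omega> n"
  let ?C = "\<lambda>w. cylinder (fun_upd \<omega> (Suc n) w) (Suc n)"
  let ?R = "cylinder \<omega> n - (\<Union>w\<in>?U. ?C w)"
  note [measurable] = sets_cylinder[of _ _ V E s] B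
  have sub: "?C w \<subseteq> cylinder \<omega> n" for w
    by (auto simp: cylinder_fun_upd_Suc)
  have "prob (\<Union>w\<in>?U. ?C w) = (\<Sum>w\<in>?U. prob (?C w))"
  proof (rule finite_measure_finite_Union[OF assms(1)])
    show "?C ` ?U \<subseteq> events"
      using sets_cylinder by blast
    show "disjoint_family_on ?C ?U"
      by (auto simp: disjoint_family_on_def cylinder_fun_upd_Suc)
  qed
  also have "\<dots> = (\<Sum>w\<in>?U. prob (cylinder \<omega> n) / card ?U)"
    using assms(1) by (intro sum.cong refl measure_cylinder_extend)
  also have "\<dots> = prob (cylinder \<omega> n)"
    using assms by simp
  finally have "prob ?R = 0"
    using sub by (subst finite_measure_Diff) (auto intro!: sets_cylinder sets.finite_UN assms(1))
  have R: "?R \<in> events"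
    by (intro sets.Diff sets.finite_UN assms(1) sets_cylinder)
  have "prob (cylinder \<omega> n \<inter> B) \<le> prob (?R \<union> (\<Union>w\<in>?U. ?C w \<inter> B))"
    using R by (intro finite_measure_mono sets.Un sets.finite_UN assms(1)) auto
  also have "\<dots> \<le> prob ?R + prob (\<Union>w\<in>?U. ?C w \<inter> B)"
    using R by (intro measure_Un_le sets.finite_UN assms(1)) auto
  also have "\<dots> \<le> 0 + (\<Sum>w\<in>?U. prob (?C w \<inter> B))"
    using assms(1) \<open>prob ?R = 0\<close> by (intro add_mono finite_measure_subadditive_finite) auto
  finally show ?thesis by simp
qed

text \<open>
  Induction along the path into the trap. At its end no trajectory survives. At each earlier vertex
  the improved bound holds for the branch that follows the path, and the bound \<open>a\<close> is used for
  all others; as the branches are equally likely, the loss \<open>q\<close> on one of them is a loss of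
  \<open>q / card (unvisited_nbrs V E \<omega> n)\<close> on average.
\<close>

lemma survival_le_of_trap_bound:
  fixes V :: "'v::countable set" and E :: "'v \<Rightarrow> 'v \<Rightarrow> bool"
  defines "N \<equiv> {\<omega>. \<not> terminates V E \<omega>}"
  assumes fin: "\<And>v. finite {w \<in> V. E v w}"
    and a: "\<And>\<omega> n. gsaw_history V E s \<omega> n \<Longrightarrow>
      measure (gsaw V E s) (cylinder \<omega> n \<inter> N) \<le> a * measure (gsaw V E s) (cylinder \<omega> n)"
    and "0 \<le> a"
    and tb: "trap_bound V E (\<omega> ` {..n}) (\<omega> n) p"
    and hist: "gsaw_history V E s \<omega> n"
  shows "measure (gsaw V E s) (cylinder \<omega> n \<inter> N)
    \<le> (1 - p) * a * measure (gsaw V E s) (cylinder \<omega> n)"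
proof -
  interpret prob_space "gsaw V E s" by (rule prob_space_gsaw)
  have N: "N \<in> events"
    using sets.compl_sets[OF sets_terminates[of V E s]]
    by (simp add: N_def space_gsaw Compl_eq_Diff_UNIV[symmetric] Collect_neg_eq)
  show ?thesis
    using tb hist
  proof (induction "\<omega> ` {..n}" "\<omega> n" p arbitrary: \<omega> n rule: trap_bound.induct)
    case (trapped p)
    have "trapped_at V E \<omega>' n" if "\<omega>' \<in> cylinder \<omega> n" for \<omega>'
    proof -
      have "unvisited_nbrs V E \<omega>' n = unvisited_nbrs V E \<omega> n"
        by (rule unvisited_nbrs_cong) (use that in \<open>simp add: cylinder_def\<close>)
      with trapped.hyps show ?thesis
        by (simp add: trapped_at_def unvisited_nbrs_eq_free_nbrs)
    qed
    then have "cylinder \<omega> n \<inter> N = {}"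
      by (auto simp: N_def terminates_def)
    with trapped.hyps \<open>0 \<le> a\<close> show ?case
      by simp
  next
    case (step w q p)
    let ?U = "unvisited_nbrs V E \<omega> n"
    let ?C = "\<lambda>w. cylinder (fun_upd \<omega> (Suc n) w) (Suc n)"
    let ?m = "prob (cylinder \<omega> n)"
    have U: "free_nbrs V E (\<omega> ` {..n}) (\<omega> n) = ?U"
      by (simp add: unvisited_nbrs_eq_free_nbrs)
    have finU: "finite ?U"
      by (rule finite_subset[OF _ fin[of "\<omega> n"]]) (auto simp: unvisited_nbrs_def)
    have w: "w \<in> ?U"
      using step.hyps(1) U by simp
    then have c: "card ?U > 0"
      using finU by (auto simp: card_gt_0_iff)
    have hist: "gsaw_history V E s (fun_upd \<omega> (Suc n) v) (Suc n)" if "v \<in> ?U" for v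
      using gsaw_history_extend[OF step.prems that] .
    have mC: "prob (?C v) = ?m / card ?U" if "v \<in> ?U" for v
      by (rule measure_cylinder_extend[OF finU that])
    have "prob (cylinder \<omega> n \<inter> N) \<le> (\<Sum>v\<in>?U. prob (?C v \<inter> N))"
      using finU w N by (intro measure_cylinder_Int_le_sum) auto
    also have "\<dots> = prob (?C w \<inter> N) + (\<Sum>v\<in>?U - {w}. prob (?C v \<inter> N))"
      using finU w by (rule sum.remove)
    also have "\<dots> \<le> (1 - q) * a * (?m / card ?U) + (\<Sum>v\<in>?U - {w}. a * (?m / card ?U))"
    proof (intro add_mono sum_mono)
      show "prob (?C w \<inter> N) \<le> (1 - q) * a * (?m / card ?U)"
        using step.hyps(3)[OF image_atMost_fun_upd_Suc[symmetric] _ hist[OF w]] mC[OF w]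
        by simp
      show "prob (?C v \<inter> N) \<le> a * (?m / card ?U)" if "v \<in> ?U - {w}" for v
        using a[OF hist, of v] mC[of v] that by simp
    qed
    also have "\<dots> = (1 - q / card ?U) * (a * ?m)"
    proof -
      have "(\<Sum>v\<in>?U - {w}. a * (?m / card ?U)) = (real (card ?U) - 1) * (a * (?m / card ?U))"
        using finU w c by (simp add: card_Diff_singleton of_nat_diff)
      moreover have "(1 - q) * a * (m / x) + (x - 1) * (a * (m / x)) = (1 - q / x) * (a * m)"
        if "x > 0" for x m :: real
        using that by (simp add: field_simps)
      ultimately show ?thesis
        using c by (simp only: of_nat_0_less_iff)
    qed
    also have "\<dots> \<le> (1 - p) * (a * ?m)"
    proof (intro mult_right_mono)
      show "1 - q / card ?U \<le> 1 - p"
        using step.hyps(4) c by (simp add: U pos_le_divide_eq)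
    qed (use \<open>0 \<le> a\<close> in simp)
    finally show ?case
      by (simp add: mult.assoc)
  qed
qed

theorem gsaw_terminates_if_trap_bound:
  fixes V :: "'v::countable set"
  assumes fin: "\<And>v. finite {w \<in> V. E v w}"
    and tb: "\<And>\<omega> n. gsaw_history V E s \<omega> n \<Longrightarrow> trap_bound V E (\<omega> ` {..n}) (\<omega> n) p"
    and p: "0 < p" "p \<le> 1"
  shows "measure (gsaw V E s) {\<omega>. terminates V E \<omega>} = 1"
proof -
  interpret prob_space "gsaw V E s" by (rule prob_space_gsaw)
  let ?N = "{\<omega>. \<not> terminates V E \<omega>}"
  have N: "?N = space (gsaw V E s) - {\<omega>. terminates V E \<omega>}"
    by (auto simp: space_gsaw)
  have Ne: "?N \<in> events"
    unfolding N by (intro sets.compl_sets sets_terminates)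
  have *: "prob (cylinder \<omega> n \<inter> ?N) \<le> (1 - p) ^ k * prob (cylinder \<omega> n)"
    if "gsaw_history V E s \<omega> n" for \<omega> n k
    using that
  proof (induction k arbitrary: \<omega> n)
    case 0
    show ?case
      by (simp, rule finite_measure_mono) (auto intro: sets_cylinder)
  next
    case (Suc k)
    then show ?case
      using survival_le_of_trap_bound[OF fin, where a = "(1 - p) ^ k", OF Suc.IH _ tb] p by simp
  qed
  have le: "prob ?N \<le> (1 - p) ^ k" for k
  proof -
    let ?c = "cylinder (\<lambda>_. s) 0"
    have c: "prob ?c = 1"
      using measure_gsaw_cylinder_Suc[where x = "\<lambda>_. s" and n = 0 and V = V and E = E and s = s] prob_space
      by (simp add: gsaw_step_def space_gsaw cylinder_def)
    \<comment> \<open>The shortest history consists of the starting vertex, and its cylinder has measure \<open>1\<close>.\<close>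
    have "AE \<omega> in gsaw V E s. \<omega> \<in> ?c"
      using c prob_eq_1[OF sets_cylinder] by blast
    then have "prob ?N = prob (?c \<inter> ?N)"
      using Ne by (intro finite_measure_eq_AE sets.Int sets_cylinder) auto
    also have "\<dots> \<le> (1 - p) ^ k * prob ?c"
      by (rule *) (simp add: gsaw_history_def)
    finally show ?thesis
      using c by simp
  qed
  have "(\<lambda>k. (1 - p) ^ k) \<longlonglongrightarrow> 0"
    using p by (intro LIMSEQ_realpow_zero) auto
  then have "prob ?N \<le> 0"
    by (rule LIMSEQ_le_const) (use le in auto)
  then have "prob ?N = 0"
    by (simp add: measure_le_0_iff)
  then show ?thesis
    using prob_compl[OF sets_terminates[of V E s]] by (simp add: N)
qed

section \<open>Trapping on the ladder\<close>

lemma finite_ladder_nbrs: "finite {w \<in> ladder_verts. ladder_adj v w}"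
  and card_ladder_nbrs_le: "v \<in> ladder_verts \<Longrightarrow> card {w \<in> ladder_verts. ladder_adj v w} \<le> 3"
proof -
  obtain a b where v: "v = (a, b)" by fastforce
  have sub: "{w \<in> ladder_verts. ladder_adj v w} \<subseteq> {a - 1..a + 1} \<times> {1, 2}"
    by (auto simp: v ladder_verts_def ladder_adj_def)
  then show "finite {w \<in> ladder_verts. ladder_adj v w}"
    by (rule finite_subset) simp
  assume "v \<in> ladder_verts"
  then have "{w \<in> ladder_verts. ladder_adj v w} \<subseteq> {(a - 1, b), (a + 1, b), (a, 3 - b)}"
    by (auto simp: v ladder_verts_def ladder_adj_def)
  then have "card {w \<in> ladder_verts. ladder_adj v w} \<le> card {(a - 1, b), (a + 1, b), (a, 3 - b)}"
    by (rule card_mono[rotated]) simp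
  also have "\<dots> \<le> 3"
    by (simp add: card_insert_if)
  finally show "card {w \<in> ladder_verts. ladder_adj v w} \<le> 3" .
qed

lemma trap_bound_ladder_step:
  assumes "v \<in> ladder_verts" "w \<in> free_nbrs ladder_verts ladder_adj S v"
    and "trap_bound ladder_verts ladder_adj (insert w S) w q" "0 \<le> q"
  shows "trap_bound ladder_verts ladder_adj S v (q / 3)"
proof (rule trap_bound.step[OF assms(2,3)])
  have "card (free_nbrs ladder_verts ladder_adj S v) \<le> card {w \<in> ladder_verts. ladder_adj v w}"
    by (intro card_mono finite_ladder_nbrs) (auto simp: free_nbrs_def)
  with card_ladder_nbrs_le[OF assms(1)]
  have "real (card (free_nbrs ladder_verts ladder_adj S v)) \<le> 3" by linarith
  from mult_left_mono[OF this assms(4)]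
  show "q / 3 * card (free_nbrs ladder_verts ladder_adj S v) \<le> q" by simp
qed

text \<open>
  The unvisited side lies in direction \<open>d\<close>. Changing rails in the first new column blocks that
  column, so that the walk cannot escape past it, whatever has been visited behind. Two steps further
  on, it changes rails again and turns back into column \<open>a + d * 2\<close>, where the
  three neighbours have all been visited.
\<close>

lemma trap_bound_fresh_half_ladder:
  assumes b: "b \<in> {1, 2}" and d: "d = 1 \<or> d = - 1"
    and fresh: "\<And>k c. k > 0 \<Longrightarrow> (a + d * k, c) \<notin> S"
  shows "trap_bound ladder_verts ladder_adj S (a, b) (1 / 3 ^ 6)"
proof -
  let ?T = "trap_bound ladder_verts ladder_adj"
  have F: "(a + d, c) \<notin> S" "(a + d * 2, c) \<notin> S" "(a + d * 3, c) \<notin> S" for c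
    using fresh[of 1] fresh[of 2] fresh[of 3] by auto
  let ?v1 = "(a + d, b)" and ?v2 = "(a + d, 3 - b)" and ?v3 = "(a + d * 2, 3 - b)"
    and ?v4 = "(a + d * 3, 3 - b)" and ?v5 = "(a + d * 3, b)" and ?v6 = "(a + d * 2, b)"
  note defs = free_nbrs_def ladder_verts_def ladder_adj_def
  have "?T (insert ?v6 (insert ?v5 (insert ?v4 (insert ?v3 (insert ?v2 (insert ?v1 S)))))) ?v6 1"
    by (rule trap_bound.trapped) (use b d in \<open>auto simp: defs\<close>)
  then have "?T (insert ?v5 (insert ?v4 (insert ?v3 (insert ?v2 (insert ?v1 S))))) ?v5 (1 / 3)"
    by (rule trap_bound_ladder_step[rotated 2]) (use b d F in \<open>auto simp: defs\<close>)
  then have "?T (insert ?v4 (insert ?v3 (insert ?v2 (insert ?v1 S)))) ?v4 (1 / 3 / 3)"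
    by (rule trap_bound_ladder_step[rotated 2]) (use b d F in \<open>auto simp: defs\<close>)
  then have "?T (insert ?v3 (insert ?v2 (insert ?v1 S))) ?v3 (1 / 3 / 3 / 3)"
    by (rule trap_bound_ladder_step[rotated 2]) (use b d F in \<open>auto simp: defs\<close>)
  then have "?T (insert ?v2 (insert ?v1 S)) ?v2 (1 / 3 / 3 / 3 / 3)"
    by (rule trap_bound_ladder_step[rotated 2]) (use b d F in \<open>auto simp: defs\<close>)
  then have "?T (insert ?v1 S) ?v1 (1 / 3 / 3 / 3 / 3 / 3)"
    by (rule trap_bound_ladder_step[rotated 2]) (use b d F in \<open>auto simp: defs\<close>)
  then have "?T S (a, b) (1 / 3 / 3 / 3 / 3 / 3 / 3)"
    by (rule trap_bound_ladder_step[rotated 2]) (use b d F in \<open>auto simp: defs\<close>)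
  then show ?thesis
    by simp
qed

lemma gsaw_history_neq:
  assumes "gsaw_history V E s \<omega> n" "i < j" "j \<le> n"
  shows "\<omega> i \<noteq> \<omega> j"
proof -
  obtain m where "j = Suc m" using assms(2) by (cases j) auto
  with assms have "\<omega> j \<notin> \<omega> ` {..m}" "i \<le> m"
    by (auto simp: gsaw_history_def unvisited_nbrs_def)
  then show ?thesis by (metis atMost_iff imageI)
qed

lemma gsaw_history_in_ladder:
  assumes "gsaw_history ladder_verts ladder_adj s \<omega> n" "s \<in> ladder_verts" "i \<le> n"
  shows "\<omega> i \<in> ladder_verts"
  using assms by (cases i) (auto simp: gsaw_history_def unvisited_nbrs_def)

text \<open>
  Columns change by at most one in each step, so a path with visits on both sides of the current
  column has crossed it before, at the other vertex of that column. This visit happened at a time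
  \<open>k < n - 1\<close>, because a later visit to one of the sides separates it from time \<open>n\<close>. So two
  different neighbours of \<open>\<omega> n\<close> are used up, namely \<open>\<omega> k\<close> and \<open>\<omega> (n - 1)\<close>, and the degree is at most
  three.
\<close>

lemma forced_between_visited_columns:
  assumes hist: "gsaw_history ladder_verts ladder_adj s \<omega> n" and s: "s \<in> ladder_verts"
    and i: "i \<le> n" "fst (\<omega> i) < fst (\<omega> n)" and j: "j \<le> n" "fst (\<omega> n) < fst (\<omega> j)"
  shows "card (unvisited_nbrs ladder_verts ladder_adj \<omega> n) \<le> 1"
proof -
  have adj: "ladder_adj (\<omega> k) (\<omega> (Suc k))" if "k < n" for k
    using hist that by (auto simp: gsaw_history_def unvisited_nbrs_def)
  have diff: "\<bar>fst (\<omega> (Suc k)) - fst (\<omega> k)\<bar> \<le> 1" if "k < n" for k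
    using adj[OF that] by (auto simp: ladder_adj_def split: prod.splits)
  have ij: "i \<noteq> n" "j \<noteq> n" "i \<noteq> j" using i j by auto
  have "\<exists>k<n - 1. fst (\<omega> k) = fst (\<omega> n)"
  proof (cases "i < j")
    case True
    have "\<exists>k. i \<le> k \<and> k \<le> j \<and> fst (\<omega> k) = fst (\<omega> n)"
      using True i j diff by (intro nat_intermed_int_val) auto
    then obtain k where k: "k \<le> j" "fst (\<omega> k) = fst (\<omega> n)"
      by blast
    moreover have "k \<noteq> j"
      using k j by auto
    ultimately show ?thesis
      using j(1) ij by (intro exI[of _ k]) auto
  next
    case False
    \<comment> \<open>Here the path runs from right to left; the sign change makes it an upward crossing.\<close>
    have "\<exists>k. j \<le> k \<and> k \<le> i \<and> - fst (\<omega> k) = - fst (\<omega> n)"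
      using False i j diff by (intro nat_intermed_int_val) (auto simp: abs_minus_commute)
    then obtain k where k: "k \<le> i" "fst (\<omega> k) = fst (\<omega> n)"
      by auto
    moreover have "k \<noteq> i"
      using k i by auto
    ultimately show ?thesis
      using i(1) ij by (intro exI[of _ k]) auto
  qed
  then obtain k where k: "k < n - 1" "fst (\<omega> k) = fst (\<omega> n)" by blast
  let ?p = "\<omega> (n - 1)"
  let ?N = "{w \<in> ladder_verts. ladder_adj (\<omega> n) w}"
  note inL = gsaw_history_in_ladder[OF hist s]
  have "snd (\<omega> k) \<noteq> snd (\<omega> n)"
    using gsaw_history_neq[OF hist, of k n] k by (auto simp: prod_eq_iff)
  then have kN: "\<omega> k \<in> ?N"
    using inL[of k] k by (auto simp: ladder_adj_def split: prod.splits)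
  have pN: "?p \<in> ?N"
    using inL[of "n - 1"] adj[of "n - 1"] k by (auto simp: ladder_adj_def split: prod.splits)
  have "unvisited_nbrs ladder_verts ladder_adj \<omega> n \<subseteq> ?N - {\<omega> k, ?p}"
    using k by (auto simp: unvisited_nbrs_def)
  then have "card (unvisited_nbrs ladder_verts ladder_adj \<omega> n) \<le> card (?N - {\<omega> k, ?p})"
    by (intro card_mono finite_Diff finite_ladder_nbrs)
  also have "\<dots> = card ?N - card {\<omega> k, ?p}"
    using kN pN by (intro card_Diff_subset) auto
  also have "card {\<omega> k, ?p} = 2"
    using gsaw_history_neq[OF hist, of k "n - 1"] k by simp
  finally show ?thesis
    using card_ladder_nbrs_le[OF inL[of n]] by simp
qed

text \<open>
  The induction is on the number of free vertices in a box that contains the history. Only forced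
  steps use the induction hypothesis, and they neither leave the box nor lower the bound.
\<close>

lemma trap_bound_ladder:
  assumes "gsaw_history ladder_verts ladder_adj s \<omega> n" and s: "s \<in> ladder_verts"
    and "\<omega> ` {..n} \<subseteq> {l..u} \<times> {1, 2}"
  shows "trap_bound ladder_verts ladder_adj (\<omega> ` {..n}) (\<omega> n) (1 / 3 ^ 6)"
  using assms(1,3)
proof (induction "card ({l..u} \<times> {1, 2} - \<omega> ` {..n})" arbitrary: \<omega> n rule: less_induct)
  case less
  let ?U = "unvisited_nbrs ladder_verts ladder_adj \<omega> n"
  obtain a b where ab: "\<omega> n = (a, b)" by fastforce
  have b: "b \<in> {1, 2}"
    using gsaw_history_in_ladder[OF less.prems(1) s, of n] by (auto simp: ab ladder_verts_def)
  consider (right) "\<And>j. j \<le> n \<Longrightarrow> fst (\<omega> j) \<le> a" | (left) "\<And>i. i \<le> n \<Longrightarrow> a \<le> fst (\<omega> i)"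
    | (between) i j where "i \<le> n" "fst (\<omega> i) < a" "j \<le> n" "a < fst (\<omega> j)"
    by (meson not_le)
  then show ?case
  proof cases
    case right
    have "(a + 1 * k, c) \<notin> \<omega> ` {..n}" if "k > 0" for k c
    proof
      assume "(a + 1 * k, c) \<in> \<omega> ` {..n}"
      then obtain i where "i \<le> n" "\<omega> i = (a + 1 * k, c)"
        by auto
      with right[of i] that show False
        by simp
    qed
    then show ?thesis
      unfolding ab by (rule trap_bound_fresh_half_ladder[OF b, of 1, rotated]) simp_all
  next
    case left
    have "(a + (- 1) * k, c) \<notin> \<omega> ` {..n}" if "k > 0" for k c
    proof
      assume "(a + (- 1) * k, c) \<in> \<omega> ` {..n}"
      then obtain i where "i \<le> n" "\<omega> i = (a + (- 1) * k, c)"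
        by auto
      with left[of i] that show False
        by simp
    qed
    then show ?thesis
      unfolding ab by (rule trap_bound_fresh_half_ladder[OF b, of "- 1", rotated]) simp_all
  next
    case between
    have c1: "card ?U \<le> 1"
      using between by (intro forced_between_visited_columns[OF less.prems(1) s, of i j]) (auto simp: ab)
    show ?thesis
    proof (cases "?U = {}")
      case True
      then show ?thesis
        by (intro trap_bound.trapped) (simp_all add: unvisited_nbrs_eq_free_nbrs)
    next
      case False
      then obtain w where w: "w \<in> ?U" by blast
      let ?\<omega> = "fun_upd \<omega> (Suc n) w"
      have "fst (\<omega> i) \<in> {l..u}" "fst (\<omega> j) \<in> {l..u}"
        using less.prems(2) between by (auto simp: image_subset_iff mem_Times_iff)
      then have wbox: "w \<in> {l..u} \<times> {1, 2}"
        using w between by (auto simp: unvisited_nbrs_def ab ladder_verts_def ladder_adj_def)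
      have "trap_bound ladder_verts ladder_adj (?\<omega> ` {..Suc n}) (?\<omega> (Suc n)) (1 / 3 ^ 6)"
      proof (rule less.hyps)
        show "card ({l..u} \<times> {1, 2} - ?\<omega> ` {..Suc n}) < card ({l..u} \<times> {1, 2} - \<omega> ` {..n})"
          unfolding image_atMost_fun_upd_Suc
          by (rule psubset_card_mono) (use wbox w in \<open>auto simp: unvisited_nbrs_def\<close>)
        show "?\<omega> ` {..Suc n} \<subseteq> {l..u} \<times> {1, 2}"
          unfolding image_atMost_fun_upd_Suc using wbox less.prems(2) by blast
      qed (rule gsaw_history_extend[OF less.prems(1) w])
      then have "trap_bound ladder_verts ladder_adj (insert w (\<omega> ` {..n})) w (1 / 3 ^ 6)"
        unfolding image_atMost_fun_upd_Suc by simp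
      then show ?thesis
        by (rule trap_bound.step[rotated]) (use w c1 in \<open>simp_all add: unvisited_nbrs_eq_free_nbrs\<close>)
    qed
  qed
qed

theorem corollary2p22:
  fixes s :: "int \<times> nat"
  assumes "s \<in> ladder_verts"
  shows "measure (gsaw ladder_verts ladder_adj s) {\<omega>. terminates ladder_verts ladder_adj \<omega>} = 1"
proof (rule gsaw_terminates_if_trap_bound[where p = "1 / 3 ^ 6"])
  fix \<omega> n
  assume hist: "gsaw_history ladder_verts ladder_adj s \<omega> n"
  let ?l = "Min (fst ` \<omega> ` {..n})" and ?u = "Max (fst ` \<omega> ` {..n})"
  have "\<omega> i \<in> {?l..?u} \<times> {1, 2}" if "i \<le> n" for i
  proof -
    have "fst (\<omega> i) \<in> fst ` \<omega> ` {..n}"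
      using that by blast
    then have "fst (\<omega> i) \<in> {?l..?u}"
      unfolding atLeastAtMost_iff by (intro conjI Min_le Max_ge finite_imageI) blast+
    with gsaw_history_in_ladder[OF hist assms that] show ?thesis
      by (simp add: ladder_verts_def mem_Times_iff)
  qed
  then have "\<omega> ` {..n} \<subseteq> {?l..?u} \<times> {1, 2}"
    by blast
  then show "trap_bound ladder_verts ladder_adj (\<omega> ` {..n}) (\<omega> n) (1 / 3 ^ 6)"
    by (rule trap_bound_ladder[OF hist assms])
qed (simp_all add: finite_ladder_nbrs)

end
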